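(* Let $k$ be a field of characteristic zero and let $f(z), g(z) \in k[z]$ be polynomials in one variable $z$. Then $k[f(z),g(z)] = k[z]$ if and only if $k[f(z),g(z)] \neq k$ and both derivatives $f'(z)$ and $g'(z)$ belong to $k[f(z),g(z)]$.
   Context: $k[f(z),g(z)]$ denotes the $k$-subalgebra of $k[z]$ generated by $f(z)$ and $g(z)$, and $f'(z), g'(z)$ denote the derivatives with respect to $z$. *)

theory Defs
  imports "HOL-Computational_Algebra.Polynomial" "HOL.Hull"
begin

(* Unital subalgebras over the coefficient field: 0 and negatives are scalar multiples
   of members, so additive subgroup closure is implied. *)
definition subalgebra :: "'a::field poly set \<Rightarrow> bool" where
  "subalgebra A \<longleftrightarrow>
     1 \<in> A \<and>
     (\<forall>p\<in>A. \<forall>q\<in>A. p + q \<in> A) \<and>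
     (\<forall>p\<in>A. \<forall>q\<in>A. p * q \<in> A) \<and>
     (\<forall>c. \<forall>p\<in>A. smult c p \<in> A)"

definition generated_subalgebra :: "'a::field poly set \<Rightarrow> 'a poly set" where
  "generated_subalgebra S = subalgebra hull S"

(* The field k, viewed inside k[z]. *)
definition constant_polys :: "'a::field poly set" where
  "constant_polys = range (\<lambda>c. [:c:])"

end

theory Submission
  imports Defs
begin

text \<open>
  Membership of the derivatives of the generators makes the whole algebra
  \<open>A = k[f, g]\<close> stable under \<open>d/dz\<close>, by the Leibniz rule. If \<open>A\<close> also contains a nonconstant
  polynomial, differentiating it repeatedly lowers the degree by exactly one each time
  (characteristic zero), so \<open>A\<close> contains a polynomial of degree one. Since \<open>A\<close> contains
  the scalars, it contains \<open>z\<close>, and hence every polynomial.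
\<close>

lemma subalgebra_generated: "subalgebra (generated_subalgebra S)"
  unfolding generated_subalgebra_def
  by (rule hull_in) (simp add: subalgebra_def)

lemma generators_subset: "S \<subseteq> generated_subalgebra S"
  unfolding generated_subalgebra_def by (rule hull_subset)

lemma generated_subalgebra_least:
  "S \<subseteq> A \<Longrightarrow> subalgebra A \<Longrightarrow> generated_subalgebra S \<subseteq> A"
  unfolding generated_subalgebra_def by (rule hull_minimal)

lemma subalgebra_add: "subalgebra A \<Longrightarrow> p \<in> A \<Longrightarrow> q \<in> A \<Longrightarrow> p + q \<in> A"
  and subalgebra_mult: "subalgebra A \<Longrightarrow> p \<in> A \<Longrightarrow> q \<in> A \<Longrightarrow> p * q \<in> A"
  and subalgebra_smult: "subalgebra A \<Longrightarrow> p \<in> A \<Longrightarrow> smult c p \<in> A"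
  and subalgebra_one: "subalgebra A \<Longrightarrow> 1 \<in> A"
  by (simp_all add: subalgebra_def)

lemma subalgebra_const:
  assumes "subalgebra A"
  shows "[:c:] \<in> A"
proof -
  have "smult c 1 \<in> A"
    by (intro subalgebra_smult subalgebra_one assms)
  then show ?thesis by simp
qed

text \<open>By the Leibniz rule, the elements of a subalgebra whose derivative stays in it form
  a subalgebra; once this contains the generators, it is everything.\<close>

lemma pderiv_in_generated_subalgebra:
  assumes gens: "\<And>s. s \<in> S \<Longrightarrow> pderiv s \<in> generated_subalgebra S"
    and p: "p \<in> generated_subalgebra S"
  shows "pderiv p \<in> generated_subalgebra S"
proof -
  let ?A = "generated_subalgebra S"
  let ?B = "{q \<in> ?A. pderiv q \<in> ?A}"
  have A: "subalgebra ?A" by (rule subalgebra_generated)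
  have "0 \<in> ?A"
    using subalgebra_const[OF A, of 0] by simp
  with A have "subalgebra ?B"
    by (auto simp: subalgebra_def pderiv_add pderiv_mult pderiv_smult)
  moreover have "S \<subseteq> ?B"
    using gens generators_subset by blast
  ultimately have "?A \<subseteq> ?B"
    by (intro generated_subalgebra_least)
  with p show ?thesis by blast
qed

lemma subalgebra_eq_UNIV_if_variable:
  assumes A: "subalgebra A" and z: "[:0, 1:] \<in> A"
  shows "A = UNIV"
proof -
  have "p \<in> A" for p
  proof (induction p)
    case 0
    show ?case using subalgebra_const[OF A, of 0] by simp
  next
    case (pCons c p)
    have "[:c:] + [:0, 1:] * p \<in> A"
      by (intro subalgebra_add subalgebra_mult subalgebra_const A z pCons.IH)
    then show ?case by simp
  qed
  then show ?thesis by blast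
qed

text \<open>The minimal positive degree of an element of \<open>A\<close> must be one, for otherwise the
  derivative would be nonconstant of smaller degree; this step fails in characteristic
  \<open>p\<close>, where \<open>k[z\<^sup>p]\<close> is a proper subalgebra killed by \<open>d/dz\<close>.\<close>

lemma pderiv_closed_subalgebra_eq_UNIV:
  fixes A :: "'a::field_char_0 poly set"
  assumes A: "subalgebra A"
    and closed: "\<And>p. p \<in> A \<Longrightarrow> pderiv p \<in> A"
    and p: "p \<in> A" "degree p > 0"
  shows "A = UNIV"
  using p
proof (induction "degree p" arbitrary: p rule: less_induct)
  case less
  show ?case
  proof (cases "degree p = 1")
    case True
    obtain b q where p_q: "p = pCons b q"
      by (rule pCons_cases)
    with True have q: "degree q = 0" "q \<noteq> 0"
      by (simp_all add: degree_pCons_eq_if split: if_splits)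
    obtain a where q_eq: "q = [:a:]"
      using q(1) by (rule degree_eq_zeroE)
    have a: "a \<noteq> 0"
      using q(2) by (simp add: q_eq)
    have p_eq: "p = [:b, a:]"
      by (simp only: p_q q_eq)
    have "smult (inverse a) (p + [:- b:]) \<in> A"
      by (intro subalgebra_smult subalgebra_add subalgebra_const A less.prems(1))
    moreover have "smult (inverse a) (p + [:- b:]) = [:0, 1:]"
      using a by (simp add: p_eq)
    ultimately have "[:0, 1:] \<in> A" by simp
    then show ?thesis
      by (rule subalgebra_eq_UNIV_if_variable[OF A])
  next
    case False
    with less.prems(2) have deg: "degree (pderiv p) < degree p" "degree (pderiv p) > 0"
      by (auto simp: degree_pderiv)
    show ?thesis
      by (rule less.hyps[OF deg(1) closed[OF less.prems(1)] deg(2)])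
  qed
qed

theorem theorem3p3:
  fixes f g :: "'a::field_char_0 poly"
  shows "generated_subalgebra {f, g} = UNIV \<longleftrightarrow>
    generated_subalgebra {f, g} \<noteq> constant_polys \<and>
    pderiv f \<in> generated_subalgebra {f, g} \<and>
    pderiv g \<in> generated_subalgebra {f, g}"
proof
  assume "generated_subalgebra {f, g} = UNIV"
  moreover have "[:0, 1:] \<notin> (constant_polys :: 'a poly set)"
    by (auto simp: constant_polys_def)
  ultimately show "generated_subalgebra {f, g} \<noteq> constant_polys \<and>
      pderiv f \<in> generated_subalgebra {f, g} \<and>
      pderiv g \<in> generated_subalgebra {f, g}"
    by (metis UNIV_I)
next
  let ?A = "generated_subalgebra {f, g}"
  assume *: "?A \<noteq> constant_polys \<and> pderiv f \<in> ?A \<and> pderiv g \<in> ?A"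
  have A: "subalgebra ?A" by (rule subalgebra_generated)
  have "constant_polys \<subseteq> ?A"
    using subalgebra_const[OF A] by (auto simp: constant_polys_def)
  with * obtain p where p: "p \<in> ?A" "p \<notin> constant_polys"
    by blast
  have "degree p > 0"
  proof (rule gr0I)
    assume "degree p = 0"
    then obtain c where "p = [:c:]" by (rule degree_eq_zeroE)
    with p(2) show False by (simp add: constant_polys_def)
  qed
  have gens: "pderiv s \<in> ?A" if "s \<in> {f, g}" for s
    using * that by (elim insertE emptyE) simp_all
  show "?A = UNIV"
    by (rule pderiv_closed_subalgebra_eq_UNIV
        [OF A pderiv_in_generated_subalgebra[OF gens] p(1) \<open>degree p > 0\<close>])
qed

end
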